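(* Let $f\colon \mathbb{R}^n\to\mathbb{R}$ be convex and coordinate-wise $L$-smooth (with $L>0$), and suppose that $X^\star := \arg\min_{x\in\mathbb{R}^n} f(x)$ is nonempty. Let $x_0\in\mathbb{R}^n$ and let $$R_1 := \max_{x^\star\in X^\star}\ \max_{x\in\mathbb{R}^n}\left\{ \|x-x^\star\|_1 \ \middle|\ f(x)\le f(x_0)\right\},$$ assumed to be well defined (finite). Then every sequence $\{x_t\}_{t\ge 0}$ generated by steepest coordinate descent (SCD) started at $x_0$ satisfies, for every $t\ge 1$ and $x^\star\in X^\star$, $$f(x_t)-f(x^\star)\le \frac{2LR_1^2}{t}.$$
   Context: Write $e_i$ for the standard unit vectors of $\mathbb{R}^n$, $[n]=\{1,\dots,n\}$, and $\nabla_i f$ for the $i$-th component of $\nabla f$. A differentiable function $f\colon\mathbb{R}^n\to\mathbb{R}$ is coordinate-wise $L$-smooth if $|\nabla_i f(x+\eta e_i)-\nabla_i f(x)|\le L|\eta|$ for all $x\in\mathbb{R}^n$, $\eta\in\mathbb{R}$, $i\in[n]$. Steepest coordinate descent (SCD): given $x_0$, for $t\ge 0$ choose $i_t\in\arg\max_{i\in[n]}|\nabla_i f(x_t)|$ and set $x_{t+1}=x_t-\frac1L\nabla_{i_t}f(x_t)\,e_{i_t}$. *)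

theory Defs
  imports "HOL-Analysis.Analysis"
begin

definition gradient :: "('a::real_inner \<Rightarrow> real) \<Rightarrow> 'a \<Rightarrow> 'a" where
  "gradient f x = (THE D. GDERIV f x :> D)"

lemma GDERIV_gradient:
  fixes f :: "'a::euclidean_space \<Rightarrow> real"
  assumes "f differentiable (at x)"
  shows "GDERIV f x :> gradient f x"
proof -
  obtain f' where f': "(f has_derivative f') (at x)"
    using assms by (auto simp: differentiable_def)
  then interpret bounded_linear f' by (rule has_derivative_bounded_linear)
  have "linear f'" by unfold_locales
  define D where "D = adjoint f' 1"
  have "f' = (\<lambda>h. h \<bullet> D)"
  proof
    show "f' h = h \<bullet> D" for h
      using adjoint_works[OF \<open>linear f'\<close>, of h 1] by (simp add: D_def)
  qed
  then have D: "GDERIV f x :> D"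
    using f' by (simp add: gderiv_def)
  have "D' = D" if "GDERIV f x :> D'" for D'
  proof -
    have "(\<lambda>h. h \<bullet> D') = (\<lambda>h. h \<bullet> D)"
      using that D unfolding gderiv_def by (rule has_derivative_unique)
    then have "\<forall>h. h \<bullet> D' = h \<bullet> D" by (blast dest: fun_cong)
    then show ?thesis by (rule vector_eq_ldot[THEN iffD1])
  qed
  with D show ?thesis
    unfolding gradient_def by (rule theI)
qed

definition coordinatewise_smooth :: "real \<Rightarrow> (real ^ 'n \<Rightarrow> real) \<Rightarrow> bool" where
  "coordinatewise_smooth L f \<longleftrightarrow>
     (\<forall>x. f differentiable (at x)) \<and>
     (\<forall>x \<eta> i. \<bar>gradient f (x + \<eta> *\<^sub>R axis i 1) $ i - gradient f x $ i\<bar> \<le> L * \<bar>\<eta>\<bar>)"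

definition minimizers :: "('a \<Rightarrow> real) \<Rightarrow> 'a set" where
  "minimizers f = {x. is_arg_min f (\<lambda>_. True) x}"

definition l1_norm :: "real ^ 'n \<Rightarrow> real" where
  "l1_norm x = (\<Sum>i\<in>UNIV. \<bar>x $ i\<bar>)"

definition R1_finite :: "(real ^ 'n \<Rightarrow> real) \<Rightarrow> real ^ 'n \<Rightarrow> bool" where
  "R1_finite f x0 \<longleftrightarrow>
     bdd_above {l1_norm (x - xs) | xs x. xs \<in> minimizers f \<and> f x \<le> f x0}"

text \<open>
  The two maxima are written as suprema, which are meaningful only under
  \<^const>\<open>R1_finite\<close>. Lemma \<open>R1_is_max\<close> below shows that they are then attained.
\<close>

definition R1 :: "(real ^ 'n \<Rightarrow> real) \<Rightarrow> real ^ 'n \<Rightarrow> real" where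
  "R1 f x0 = (SUP xs\<in>minimizers f. SUP x\<in>{x. f x \<le> f x0}. l1_norm (x - xs))"

lemma norm_le_l1_norm: "norm x \<le> l1_norm x"
  by (simp add: l1_norm_def norm_le_l1_cart)

lemma R1_is_max:
  fixes f :: "real ^ 'n \<Rightarrow> real"
  assumes cont: "continuous_on UNIV f"
    and ne: "minimizers f \<noteq> {}" and fin: "R1_finite f x0"
  shows "\<exists>xs\<in>minimizers f. \<exists>x. f x \<le> f x0 \<and> l1_norm (x - xs) = R1 f x0"
    and "\<And>xs x. xs \<in> minimizers f \<Longrightarrow> f x \<le> f x0 \<Longrightarrow> l1_norm (x - xs) \<le> R1 f x0"
proof -
  define S where "S = {x. f x \<le> f x0}"
  define M where "M = minimizers f"
  obtain m where m: "m \<in> M" using ne by (auto simp: M_def)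
  have M_eq: "M = {x. f x \<le> f m}"
  proof
    show "M \<subseteq> {x. f x \<le> f m}"
      by (auto simp: M_def minimizers_def is_arg_min_linorder)
    have "\<And>y. f m \<le> f y"
      using m by (simp add: M_def minimizers_def is_arg_min_linorder)
    then show "{x. f x \<le> f m} \<subseteq> M"
      by (auto simp: M_def minimizers_def is_arg_min_linorder intro: order_trans)
  qed
  have MS: "M \<subseteq> S"
    by (auto simp: M_def S_def minimizers_def is_arg_min_linorder)
  obtain B where "\<forall>r\<in>{l1_norm (x - xs) | xs x. xs \<in> M \<and> x \<in> S}. r \<le> B"
    using fin unfolding R1_finite_def bdd_above_def M_def S_def mem_Collect_eq by blast
  then have B: "l1_norm (x - xs) \<le> B" if "xs \<in> M" "x \<in> S" for xs x
    using that by blast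
  have "bounded S"
  proof (rule bounded_subset[OF bounded_cball])
    show "S \<subseteq> cball m B"
    proof
      fix x assume "x \<in> S"
      from norm_le_l1_norm B[OF m this] have "norm (x - m) \<le> B" by (rule order_trans)
      then show "x \<in> cball m B" by (simp add: dist_norm norm_minus_commute)
    qed
  qed
  have closed: "closed S" "closed M"
    unfolding M_eq S_def by (intro closed_Collect_le cont continuous_on_const)+
  have "bounded M" using \<open>bounded S\<close> MS by (rule bounded_subset)
  have comp: "compact (M \<times> S)"
    using \<open>bounded S\<close> \<open>bounded M\<close> closed by (intro compact_Times) (simp_all add: compact_eq_bounded_closed)
  have "M \<times> S \<noteq> {}" using m MS by auto
  moreover have "continuous_on (M \<times> S) (\<lambda>p. l1_norm (snd p - fst p))"
    unfolding l1_norm_def by (intro continuous_intros)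
  ultimately obtain p where p: "p \<in> M \<times> S"
      and pmax: "\<And>q. q \<in> M \<times> S \<Longrightarrow> l1_norm (snd q - fst q) \<le> l1_norm (snd p - fst p)"
    using continuous_attains_sup[OF comp] by blast
  define a b where "a = fst p" and "b = snd p"
  have a: "a \<in> M" and b: "b \<in> S" using p by (auto simp: a_def b_def)
  have mx: "l1_norm (x - xs) \<le> l1_norm (b - a)" if "xs \<in> M" "x \<in> S" for xs x
    using pmax[of "(xs, x)"] that by (simp add: a_def b_def)
  have inner: "(SUP x\<in>S. l1_norm (x - a)) = l1_norm (b - a)"
    by (rule cSup_eq_maximum) (use a b mx in auto)
  have "(SUP xs\<in>M. SUP x\<in>S. l1_norm (x - xs)) = l1_norm (b - a)"
  proof (rule cSup_eq_maximum)
    show "l1_norm (b - a) \<in> (\<lambda>xs. SUP x\<in>S. l1_norm (x - xs)) ` M"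
      by (rule image_eqI[where x = a]) (rule inner[symmetric], rule a)
    show "y \<le> l1_norm (b - a)" if y_in: "y \<in> (\<lambda>xs. SUP x\<in>S. l1_norm (x - xs)) ` M" for y
    proof -
      obtain xs where "xs \<in> M" and y: "y = (SUP x\<in>S. l1_norm (x - xs))"
        using y_in by blast
      from b have "S \<noteq> {}" by blast
      then show ?thesis
        unfolding y using mx[OF \<open>xs \<in> M\<close>] by (rule cSUP_least)
    qed
  qed
  then have R1: "R1 f x0 = l1_norm (b - a)"
    by (simp add: R1_def M_def S_def)
  show "\<exists>xs\<in>minimizers f. \<exists>x. f x \<le> f x0 \<and> l1_norm (x - xs) = R1 f x0"
    using a b R1 by (auto simp: M_def S_def)
  show "l1_norm (x - xs) \<le> R1 f x0" if "xs \<in> minimizers f" "f x \<le> f x0" for xs x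
    using mx[of xs x] that R1 by (simp add: M_def S_def)
qed

text \<open>The choice among tied coordinates in the arg max is unconstrained and may vary with \<open>t\<close>.\<close>

definition scd_sequence ::
  "real \<Rightarrow> (real ^ 'n \<Rightarrow> real) \<Rightarrow> real ^ 'n \<Rightarrow> (nat \<Rightarrow> real ^ 'n) \<Rightarrow> bool" where
  "scd_sequence L f x0 x \<longleftrightarrow>
     x 0 = x0 \<and>
     (\<forall>t. \<exists>i. is_arg_max (\<lambda>j. \<bar>gradient f (x t) $ j\<bar>) (\<lambda>_. True) i \<and>
        x (Suc t) = x t - ((1 / L) * gradient f (x t) $ i) *\<^sub>R axis i 1)"

end

theory Submission
  imports Defs
begin

text \<open>
  A step along a coordinate of maximal gradient decreases \<open>f\<close> by at least
  \<open>\<parallel>\<nabla>f\<parallel>\<^sub>\<infinity>\<^sup>2 / (2L)\<close>, whereas convexity and Hoelder's inequality bound the gap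
  \<open>d\<^sub>t = f(x\<^sub>t) - f(x\<^sup>*)\<close> by \<open>\<parallel>\<nabla>f\<parallel>\<^sub>\<infinity> R\<^sub>1\<close>, since the iterates never leave the
  initial sublevel set. Hence \<open>d\<^sub>t\<^sup>2 \<le> 2 L R\<^sub>1\<^sup>2 (d\<^sub>t - d\<^sub>t\<^sub>+\<^sub>1)\<close>, a recursion that forces
  the rate \<open>1/t\<close>.
\<close>

text \<open>Reduces both the convexity and the smoothness estimate to one-variable calculus.\<close>

lemma has_real_derivative_along_line:
  fixes f :: "'a::euclidean_space \<Rightarrow> real"
  assumes "f differentiable (at (x + s *\<^sub>R v))"
  shows "((\<lambda>s. f (x + s *\<^sub>R v)) has_real_derivative gradient f (x + s *\<^sub>R v) \<bullet> v) (at s)"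
proof -
  have "((\<lambda>s. f (x + s *\<^sub>R v)) has_derivative (\<lambda>h. (h *\<^sub>R v) \<bullet> gradient f (x + s *\<^sub>R v))) (at s)"
  proof (rule has_derivative_compose[where g = f])
    show "((\<lambda>s. x + s *\<^sub>R v) has_derivative (\<lambda>h. h *\<^sub>R v)) (at s)"
      by (auto intro!: derivative_eq_intros)
    show "(f has_derivative (\<lambda>h. h \<bullet> gradient f (x + s *\<^sub>R v))) (at (x + s *\<^sub>R v))"
      using GDERIV_gradient[OF assms] by (simp add: gderiv_def)
  qed
  then show ?thesis
    by (simp add: has_field_derivative_def inner_commute mult.commute[of _ "v \<bullet> _"])
qed

lemma convex_on_gradient_ineq:
  fixes f :: "'a::euclidean_space \<Rightarrow> real"
  assumes "convex_on UNIV f" and "f differentiable (at x)"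
  shows "f x + gradient f x \<bullet> (y - x) \<le> f y"
proof -
  define h where "h = (\<lambda>s. f (x + s *\<^sub>R (y - x)))"
  have "convex_on UNIV h"
  proof (rule convex_onI)
    fix t a b :: real assume t: "0 < t" "t < 1"
    have "x + ((1 - t) *\<^sub>R a + t *\<^sub>R b) *\<^sub>R (y - x)
        = (1 - t) *\<^sub>R (x + a *\<^sub>R (y - x)) + t *\<^sub>R (x + b *\<^sub>R (y - x))"
      by (simp add: algebra_simps)
    then show "h ((1 - t) *\<^sub>R a + t *\<^sub>R b) \<le> (1 - t) * h a + t * h b"
      unfolding h_def using convex_onD[OF assms(1), of t] t by simp
  qed simp
  moreover have "(h has_real_derivative gradient f x \<bullet> (y - x)) (at 0)"
    using has_real_derivative_along_line[where f = f and x = x and s = 0 and v = "y - x"] assms(2) by (simp add: h_def)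
  ultimately have "h 1 - h 0 \<ge> (gradient f x \<bullet> (y - x)) * (1 - 0)"
    by (intro convex_on_imp_above_tangent[where A = UNIV]) auto
  then show ?thesis by (simp add: h_def)
qed

text \<open>Subtracting the quadratic model from \<open>f\<close> along the segment leaves a
  function with nonpositive derivative, so comparing its endpoints replaces integrating the
  gradient.\<close>

lemma coordinatewise_smooth_upper_bound:
  fixes f :: "real ^ 'n \<Rightarrow> real"
  assumes "coordinatewise_smooth L f"
  shows "f (x + \<eta> *\<^sub>R axis i 1) \<le> f x + gradient f x $ i * \<eta> + L / 2 * \<eta>\<^sup>2"
proof -
  define g where "g = gradient f x $ i"
  \<comment> \<open>The segment is parametrised by \<open>s\<close> from 0 to 1 with
    \<open>\<eta>\<close> inside the direction, so no case split on the sign of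
    \<open>\<eta>\<close> arises.\<close>
  define \<phi> where
    "\<phi> s = f (x + s *\<^sub>R (\<eta> *\<^sub>R axis i 1)) - g * \<eta> * s - L / 2 * \<eta>\<^sup>2 * s\<^sup>2" for s :: real
  have "\<phi> 1 \<le> \<phi> 0"
  proof (rule DERIV_nonpos_imp_nonincreasing[where f = \<phi>])
    fix s :: real assume "0 \<le> s"
    define D where "D = gradient f (x + s *\<^sub>R (\<eta> *\<^sub>R axis i 1)) $ i"
    have "f differentiable (at z)" for z
      using assms by (simp add: coordinatewise_smooth_def)
    from has_real_derivative_along_line[OF this, where x = x and s = s and v = "\<eta> *\<^sub>R axis i 1"]
    have "((\<lambda>s. f (x + s *\<^sub>R (\<eta> *\<^sub>R axis i 1))) has_real_derivative D * \<eta>) (at s)"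
      by (simp add: D_def inner_axis mult.commute)
    then have "(\<phi> has_real_derivative D * \<eta> - g * \<eta> - L * \<eta>\<^sup>2 * s) (at s)"
      unfolding \<phi>_def by (auto intro!: derivative_eq_intros)
    moreover have "(D - g) * \<eta> \<le> L * \<eta>\<^sup>2 * s"
    proof -
      \<comment> \<open>Smoothness is applied to the displacement \<open>s * \<eta>\<close> along
        coordinate \<open>i\<close>.\<close>
      have "\<bar>D - g\<bar> \<le> L * \<bar>s * \<eta>\<bar>"
        using assms unfolding coordinatewise_smooth_def D_def g_def by (metis scaleR_scaleR)
      then have "\<bar>D - g\<bar> * \<bar>\<eta>\<bar> \<le> L * \<bar>s * \<eta>\<bar> * \<bar>\<eta>\<bar>"
        by (rule mult_right_mono) simp
      also have "\<dots> = L * \<eta>\<^sup>2 * s"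
        using \<open>0 \<le> s\<close> by (simp add: abs_mult power2_eq_square)
      finally show ?thesis
        by (metis abs_ge_self abs_mult order_trans)
    qed
    ultimately show "\<exists>y. (\<phi> has_real_derivative y) (at s) \<and> y \<le> 0"
      by (auto simp: algebra_simps)
  qed simp
  then show ?thesis by (simp add: \<phi>_def g_def)
qed

text \<open>The step length minimises the quadratic upper bound along coordinate
  \<open>i\<close>.\<close>

lemma coordinate_step_decrease:
  fixes f :: "real ^ 'n \<Rightarrow> real"
  assumes "coordinatewise_smooth L f" and "L > 0"
  shows "f (x - ((1 / L) * gradient f x $ i) *\<^sub>R axis i 1) \<le> f x - (gradient f x $ i)\<^sup>2 / (2 * L)"
  using coordinatewise_smooth_upper_bound[OF assms(1), of x "- ((1 / L) * gradient f x $ i)" i] assms(2)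
  by (simp add: power2_eq_square field_simps)

lemma inner_le_max_times_l1_norm:
  fixes g v :: "real ^ 'n"
  assumes "\<And>j. \<bar>g $ j\<bar> \<le> M"
  shows "g \<bullet> v \<le> M * l1_norm v"
proof -
  have "g $ j * v $ j \<le> M * \<bar>v $ j\<bar>" for j
    using mult_right_mono[OF assms abs_ge_zero, of j "v $ j"] by (metis abs_ge_self abs_mult order_trans)
  then show ?thesis
    unfolding l1_norm_def inner_vec_def sum_distrib_left by (intro sum_mono) simp
qed

text \<open>Induction on \<open>t\<close> in a form that avoids the usual passage to reciprocals
  \<open>1 / d t\<close>, so vanishing gaps need no separate treatment.\<close>

lemma quadratic_decrease_imp_inverse_rate:
  fixes d :: "nat \<Rightarrow> real"
  assumes "C \<ge> 0" and nonneg: "\<And>t. 0 \<le> d t"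
    and dec: "\<And>t. (d t)\<^sup>2 \<le> C * (d t - d (Suc t))"
  shows "real t * d t \<le> C"
proof (cases "C = 0")
  \<comment> \<open>Here \<open>dec\<close> forces \<open>d t = 0\<close>.\<close>
  case True
  with dec[of t] show ?thesis by simp
next
  case False
  with \<open>C \<ge> 0\<close> have "C > 0" by simp
  show ?thesis
  proof (induction t)
    case 0
    show ?case using \<open>C \<ge> 0\<close> by simp
  next
    case (Suc t)
    have "0 \<le> C * (d t - d (Suc t))"
      using dec[of t] zero_le_power2 order_trans by blast
    with \<open>C > 0\<close> have "d (Suc t) \<le> d t"
      by (simp add: zero_le_mult_iff)
    \<comment> \<open>Replacing one factor of the square by the smaller \<open>d (Suc t)\<close>
      makes the recursion linear in \<open>d (Suc t)\<close>.\<close>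
    then have "d (Suc t) * d t \<le> (d t)\<^sup>2"
      using nonneg[of t] by (simp add: power2_eq_square mult_right_mono)
    with dec[of t] have "d (Suc t) * (d t + C) \<le> C * d t"
      by (simp add: algebra_simps)
    then have "real (Suc t) * (d (Suc t) * (d t + C)) \<le> real (Suc t) * (C * d t)"
      by (rule mult_left_mono) simp
    also have "\<dots> = C * (real t * d t + d t)"
      by (simp add: algebra_simps)
    also have "\<dots> \<le> C * (C + d t)"
      using Suc.IH \<open>C > 0\<close> by simp
    \<comment> \<open>Both sides now share the positive factor \<open>d t + C\<close>, which
      cancels.\<close>
    finally have "(real (Suc t) * d (Suc t)) * (d t + C) \<le> C * (d t + C)"
      by (simp add: algebra_simps)
    then show ?case
      by (rule mult_right_le_imp_le) (use \<open>C > 0\<close> nonneg[of t] in linarith)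
  qed
qed

theorem theorem2p1:
  fixes f :: "real ^ 'n \<Rightarrow> real" and L :: real
    and x0 :: "real ^ 'n" and x :: "nat \<Rightarrow> real ^ 'n"
  assumes "L > 0"
    and "convex_on UNIV f"
    and "coordinatewise_smooth L f"
    and "minimizers f \<noteq> {}"
    and "R1_finite f x0"
    and "scd_sequence L f x0 x"
  shows "\<forall>t\<ge>1. \<forall>xs\<in>minimizers f. f (x t) - f xs \<le> 2 * L * (R1 f x0)\<^sup>2 / real t"
proof (intro allI impI ballI)
  fix t :: nat and xs assume "1 \<le> t" and xs: "xs \<in> minimizers f"
  define d where "d t = f (x t) - f xs" for t
  define R where "R = R1 f x0"
  have diff: "f differentiable (at z)" for z
    using assms(3) by (simp add: coordinatewise_smooth_def)
  then have cont: "continuous_on UNIV f"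
    by (simp add: continuous_at_imp_continuous_on differentiable_imp_continuous_within)
  have nonneg: "0 \<le> d t" for t
    using xs by (simp add: d_def minimizers_def is_arg_min_linorder)
  \<comment> \<open>Maximality of \<open>i\<close> is kept beside the decrease: the same gradient
    entry must also bound the gap.\<close>
  have step: "\<exists>i. (\<forall>j. \<bar>gradient f (x t) $ j\<bar> \<le> \<bar>gradient f (x t) $ i\<bar>) \<and>
      f (x (Suc t)) \<le> f (x t) - (gradient f (x t) $ i)\<^sup>2 / (2 * L)" for t
  proof -
    obtain i where "is_arg_max (\<lambda>j. \<bar>gradient f (x t) $ j\<bar>) (\<lambda>_. True) i"
        and "x (Suc t) = x t - ((1 / L) * gradient f (x t) $ i) *\<^sub>R axis i 1"
      using assms(6) unfolding scd_sequence_def by blast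
    then show ?thesis
      using coordinate_step_decrease[OF assms(3,1)] by (auto simp: is_arg_max_linorder)
  qed
  have "f (x (Suc t)) \<le> f (x t)" for t
  proof -
    obtain i where "f (x (Suc t)) \<le> f (x t) - (gradient f (x t) $ i)\<^sup>2 / (2 * L)"
      using step by blast
    moreover have "0 \<le> (gradient f (x t) $ i)\<^sup>2 / (2 * L)"
      using \<open>L > 0\<close> by simp
    ultimately show ?thesis by linarith
  qed
  then have "decseq (\<lambda>t. f (x t))" by (rule decseq_SucI)
  \<comment> \<open>This puts every iterate among the points over which \<open>R1\<close> is
    taken.\<close>
  then have sublevel: "f (x t) \<le> f x0" for t
    using assms(6) by (auto simp: decseq_def scd_sequence_def)
  have "(d t)\<^sup>2 \<le> 2 * L * R\<^sup>2 * (d t - d (Suc t))" for t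
  proof -
    obtain i where mx: "\<And>j. \<bar>gradient f (x t) $ j\<bar> \<le> \<bar>gradient f (x t) $ i\<bar>"
        and dec: "f (x (Suc t)) \<le> f (x t) - (gradient f (x t) $ i)\<^sup>2 / (2 * L)"
      using step by blast
    define M where "M = \<bar>gradient f (x t) $ i\<bar>"
    have "d t \<le> gradient f (x t) \<bullet> (x t - xs)"
      using convex_on_gradient_ineq[OF assms(2) diff, of "x t" xs]
      by (simp add: d_def inner_diff_right)
    also have "\<dots> \<le> M * l1_norm (x t - xs)"
      using mx unfolding M_def by (rule inner_le_max_times_l1_norm)
    also have "\<dots> \<le> M * R"
      unfolding R_def M_def
      by (intro mult_left_mono R1_is_max(2)[OF cont assms(4,5) xs sublevel]) simp
    \<comment> \<open>Squaring preserves the bound because the gap is nonnegative.\<close>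
    finally have "(d t)\<^sup>2 \<le> (M * R)\<^sup>2"
      using nonneg by (rule power_mono)
    also have "\<dots> = R\<^sup>2 * M\<^sup>2" by (simp add: power_mult_distrib)
    \<comment> \<open>The one-step decrease solved for \<open>M\<^sup>2\<close>; \<open>f xs\<close>
      cancels in the difference of gaps.\<close>
    also have "\<dots> \<le> R\<^sup>2 * (2 * L * (d t - d (Suc t)))"
      using dec \<open>L > 0\<close> by (intro mult_left_mono) (simp_all add: d_def M_def field_simps)
    finally show ?thesis by (simp add: algebra_simps)
  qed
  with nonneg have "real t * d t \<le> 2 * L * R\<^sup>2"
    using \<open>L > 0\<close> by (intro quadratic_decrease_imp_inverse_rate) simp_all
  then show "f (x t) - f xs \<le> 2 * L * (R1 f x0)\<^sup>2 / real t"
    using \<open>1 \<le> t\<close> by (simp add: d_def R_def field_simps)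
qed

end
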